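(* Let $N$ be any one of the natural deduction systems $\mathrm{nC}$, $\mathrm{nC3}$, $\mathrm{nMC}$, $\mathrm{nCN}$. All derivations in $N$ are normalizable. More precisely, if a derivation $\mathcal{D}$ in $N$ is given, then we can obtain a normal derivation $\mathcal{D}'$ in $N$ such that $\mathrm{oa}(\mathcal{D}')=\mathrm{oa}(\mathcal{D})$ and $\mathrm{end}(\mathcal{D}')=\mathrm{end}(\mathcal{D})$.
   Context: Formulas are built from countably many propositional variables $p,q,\dots$ using the binary connectives $\land,\lor,\to$ and the unary connective $\sim$. Derivations are Gentzen-style natural deduction trees; a single assumption $\alpha$ is a derivation of $\alpha$ from itself. $[\alpha]$ marks an assumption discharged by the rule. In ($\to$I), and likewise in ($\sim\to$I), the discharge can be vacuous. The rules of $\mathrm{nC}$ are: ($\to$I): from a derivation of $\beta$ from $[\alpha]$, infer $\alpha\to\beta$. ($\to$E): from $\alpha\to\beta$ and $\alpha$ infer $\beta$. ($\land$I): from $\alpha$ and $\beta$ infer $\alpha\land\beta$. ($\land$E1), ($\land$E2): from $\alpha\land\beta$ infer $\alpha$ (respectively $\beta$). ($\lor$I1), ($\lor$I2): from $\alpha$ (respectively $\beta$) infer $\alpha\lor\beta$. ($\lor$E): from $\alpha\lor\beta$, a derivation of $\gamma$ from $[\alpha]$, and a derivation of $\gamma$ from $[\beta]$, infer $\gamma$. ($\sim\sim$I): from $\alpha$ infer $\sim\sim\alpha$. ($\sim\sim$E): from $\sim\sim\alpha$ infer $\alpha$. ($\sim\to$I): from a derivation of $\sim\beta$ from $[\alpha]$,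 infer $\sim(\alpha\to\beta)$. ($\sim\to$E): from $\sim(\alpha\to\beta)$ and $\alpha$ infer $\sim\beta$. ($\sim\land$I1), ($\sim\land$I2): from $\sim\alpha$ (respectively $\sim\beta$) infer $\sim(\alpha\land\beta)$. ($\sim\land$E): from $\sim(\alpha\land\beta)$, a derivation of $\gamma$ from $[\sim\alpha]$, and a derivation of $\gamma$ from $[\sim\beta]$, infer $\gamma$. ($\sim\lor$I): from $\sim\alpha$ and $\sim\beta$ infer $\sim(\alpha\lor\beta)$. ($\sim\lor$E1), ($\sim\lor$E2): from $\sim(\alpha\lor\beta)$ infer $\sim\alpha$ (respectively $\sim\beta$). Additional rules: (EM): from a derivation of $\gamma$ from $[\sim\alpha]$ and a derivation of $\gamma$ from $[\alpha]$, infer $\gamma$. (GEM): from a derivation of $\gamma$ from $[\alpha\to\beta]$ and a derivation of $\gamma$ from $[\alpha]$, infer $\gamma$. $\mathrm{nC3}=\mathrm{nC}+$(EM); $\mathrm{nMC}=\mathrm{nC}+$(GEM); $\mathrm{nCN}=\mathrm{nC3}+$(GEM). For a derivation $\mathcal{D}$, $\mathrm{oa}(\mathcal{D})$ is the set of its open (undischarged) assumptions and $\mathrm{end}(\mathcal{D})$ is its end-formula. The rules whose names contain I, together with (EM) and (GEM), are called introduction rules; the rules whose names contain E, E1 or E2 (other than (EM), (GEM)) are called elimination rules. The major premise of an elimination rule is, as usual, the premise displaying the eliminated connective, i.e. the first premise listed above for it; (EM) and (GEM) have no major or minor premises. A formula occurring in a derivation is a maximum formula if it is (i) the conclusion of an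 introduction rule, of ($\lor$E), or of ($\sim\land$E), and (ii) the major premise of an elimination rule. A derivation is normal if it contains no maximum formula.
   Formalization: For nC the equality oa(D')=oa(D) fails (infer p∧q from p and q, then p), so for nC only oa(D')⊆oa(D) is stated; equality is kept for nC3, nMC and nCN. Vacuous discharge is allowed in all discharging rules. *)

theory Defs
  imports Main
begin

datatype fm =
    Var nat
  | And fm fm
  | Or fm fm
  | Imp fm fm
  | Neg fm

datatype rule =
    ImpI | ImpE
  | AndI | AndE1 | AndE2
  | OrI1 | OrI2 | OrE
  | NegNegI | NegNegE
  | NegImpI | NegImpE
  | NegAndI1 | NegAndI2 | NegAndE
  | NegOrI | NegOrE1 | NegOrE2
  | EM | GEM

text \<open>
  \<open>inference r ps c\<close>: the rule \<open>r\<close> infers \<open>c\<close> from the premises \<open>ps\<close>, listed from left to right.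
  A premise \<open>(Some \<alpha>, \<beta>)\<close> stands for a derivation of \<open>\<beta>\<close> from \<open>[\<alpha>]\<close>, and \<open>(None, \<beta>)\<close> for a
  derivation of \<open>\<beta>\<close> in which the rule discharges nothing.  The major premise of an elimination
  rule is always the first one.
\<close>

inductive inference :: "rule \<Rightarrow> (fm option \<times> fm) list \<Rightarrow> fm \<Rightarrow> bool" where
  "inference ImpI [(Some a, b)] (Imp a b)"
| "inference ImpE [(None, Imp a b), (None, a)] b"
| "inference AndI [(None, a), (None, b)] (And a b)"
| "inference AndE1 [(None, And a b)] a"
| "inference AndE2 [(None, And a b)] b"
| "inference OrI1 [(None, a)] (Or a b)"
| "inference OrI2 [(None, b)] (Or a b)"
| "inference OrE [(None, Or a b), (Some a, c), (Some b, c)] c"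
| "inference NegNegI [(None, a)] (Neg (Neg a))"
| "inference NegNegE [(None, Neg (Neg a))] a"
| "inference NegImpI [(Some a, Neg b)] (Neg (Imp a b))"
| "inference NegImpE [(None, Neg (Imp a b)), (None, a)] (Neg b)"
| "inference NegAndI1 [(None, Neg a)] (Neg (And a b))"
| "inference NegAndI2 [(None, Neg b)] (Neg (And a b))"
| "inference NegAndE [(None, Neg (And a b)), (Some (Neg a), c), (Some (Neg b), c)] c"
| "inference NegOrI [(None, Neg a), (None, Neg b)] (Neg (Or a b))"
| "inference NegOrE1 [(None, Neg (Or a b))] (Neg a)"
| "inference NegOrE2 [(None, Neg (Or a b))] (Neg b)"
| "inference EM [(Some (Neg a), c), (Some a, c)] c"
| "inference GEM [(Some (Imp a b), c), (Some a, c)] c"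

definition intro_rules :: "rule set" where
  "intro_rules = {ImpI, AndI, OrI1, OrI2, NegNegI, NegImpI, NegAndI1, NegAndI2, NegOrI, EM, GEM}"

definition elim_rules :: "rule set" where
  "elim_rules = {ImpE, AndE1, AndE2, OrE, NegNegE, NegImpE, NegAndE, NegOrE1, NegOrE2}"

datatype system = nC | nC3 | nMC | nCN

fun rules_of :: "system \<Rightarrow> rule set" where
  "rules_of nC = UNIV - {EM, GEM}"
| "rules_of nC3 = UNIV - {GEM}"
| "rules_of nMC = UNIV - {EM}"
| "rules_of nCN = UNIV"

text \<open>
  Every leaf carries a label, so that an inference may discharge any selection of the
  occurrences of a formula: a premise \<open>(Some (n, \<alpha>), D)\<close> discharges exactly the still open leaves
  \<open>Assm n \<alpha>\<close> of \<open>D\<close>.  There may be none of them (vacuous discharge).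
\<close>

datatype deriv =
    Assm nat fm
  | Infer rule "((nat \<times> fm) option \<times> deriv) list" fm

fun end_fm :: "deriv \<Rightarrow> fm" where
  "end_fm (Assm n a) = a"
| "end_fm (Infer r ps c) = c"

fun open_leaves :: "deriv \<Rightarrow> (nat \<times> fm) set" where
  "open_leaves (Assm n a) = {(n, a)}"
| "open_leaves (Infer r ps c) = (\<Union>(x, D) \<in> set ps. open_leaves D - set_option x)"

definition oa :: "deriv \<Rightarrow> fm set" where
  "oa D = snd ` open_leaves D"

inductive derivation :: "system \<Rightarrow> deriv \<Rightarrow> bool" for N :: system where
  assm: "derivation N (Assm n a)"
| infer: "r \<in> rules_of N \<Longrightarrow>
    inference r (map (\<lambda>(x, D). (map_option snd x, end_fm D)) ps) c \<Longrightarrow>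
    (\<And>x D. (x, D) \<in> set ps \<Longrightarrow> derivation N D) \<Longrightarrow>
    derivation N (Infer r ps c)"

fun subderivs :: "deriv \<Rightarrow> deriv set" where
  "subderivs (Assm n a) = {Assm n a}"
| "subderivs (Infer r ps c) = insert (Infer r ps c) (\<Union>(x, D) \<in> set ps. subderivs D)"

text \<open>
  The end-formula of \<open>M\<close>, occurring as the premise of the last inference of \<open>E\<close>, is a maximum
  formula.
\<close>

definition maximum :: "deriv \<Rightarrow> deriv \<Rightarrow> bool" where
  "maximum M E \<longleftrightarrow>
    (\<exists>s qs. M = Infer s qs (end_fm M) \<and> s \<in> intro_rules \<union> {OrE, NegAndE}) \<and>
    (\<exists>r x ps c. E = Infer r ((x, M) # ps) c \<and> r \<in> elim_rules)"

definition normal :: "deriv \<Rightarrow> bool" where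
  "normal D \<longleftrightarrow> \<not> (\<exists>E \<in> subderivs D. \<exists>M. maximum M E)"

text \<open>
  In \<open>nC\<close>, normalization cannot always keep the set of open assumptions: it may lose some.  The
  derivation of \<open>p\<close> from \<open>p\<close> and \<open>q\<close> by \<open>AndI\<close> and \<open>AndE1\<close> is a counterexample, because an
  elimination at the end of a normal derivation requires a compound open assumption.
  With \<open>EM\<close> or \<open>GEM\<close> a lost assumption \<open>q\<close> can be put back into a normal derivation of \<open>c\<close>, by a
  final \<open>EM\<close> on \<open>Imp q c\<close> or \<open>GEM\<close> on \<open>Imp q c\<close> and \<open>q\<close>, with a vacuous discharge.
\<close>

lemma normal_elim_open_compound:
  assumes "derivation nC D" "normal D" "D = Infer r ps c" "r \<in> elim_rules"
  shows "\<exists>a \<in> oa D. \<forall>n. a \<noteq> Var n"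
  using assms
proof (induction arbitrary: r ps c rule: derivation.induct)
  case (infer r' ps' c')
  then have [simp]: "r' = r" "ps' = ps" "c' = c" and r: "r \<in> elim_rules" by auto
  obtain M qs where ps: "ps = (None, M) # qs" and M: "\<forall>n. end_fm M \<noteq> Var n"
    using infer.hyps(2) r unfolding elim_rules_def
    by cases (auto simp: map_eq_Cons_conv)
  have sub: "oa M \<subseteq> oa (Infer r ps c)" by (auto simp: oa_def ps)
  have nM: "normal M" using infer.prems(1) by (auto simp: normal_def ps)
  show ?case
  proof (cases M)
    case (Assm n a)
    then show ?thesis using M sub by (auto simp: oa_def)
  next
    case (Infer s ss d)
    have "\<not> maximum M (Infer r ps c)" using infer.prems(1) by (auto simp: normal_def)
    then have "s \<notin> intro_rules" using Infer r by (auto simp: maximum_def ps)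
    then have "s \<in> elim_rules" by (cases s) (auto simp: intro_rules_def elim_rules_def)
    then have "\<exists>a \<in> oa M. \<forall>n. a \<noteq> Var n"
      using infer.IH[of None M] nM Infer by (auto simp: ps)
    then show ?thesis using sub by auto
  qed
qed simp

lemma nC_normalization_loses_open_assumptions:
  "\<exists>D. derivation nC D \<and>
    \<not> (\<exists>D'. derivation nC D' \<and> normal D' \<and> oa D' = oa D \<and> end_fm D' = end_fm D)"
proof -
  let ?p = "Var 0" and ?q = "Var 1"
  let ?A = "Infer AndI [(None, Assm 0 ?p), (None, Assm 0 ?q)] (And ?p ?q)"
  let ?D = "Infer AndE1 [(None, ?A)] ?p"
  have "derivation nC ?A" by (rule derivation.infer) (auto intro: inference.intros derivation.assm)
  then have "derivation nC ?D"
    by (intro derivation.infer) (auto intro: inference.intros)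
  moreover have oaD: "oa ?D = {?p, ?q}" by (auto simp: oa_def)
  moreover have False
    if d: "derivation nC D'" and n: "normal D'" and o: "oa D' = oa ?D" and e: "end_fm D' = ?p" for D'
  proof (cases D')
    case (Assm n a)
    then show False using o unfolding oaD by (auto simp: oa_def)
  next
    case (Infer r ps c)
    with d have i: "inference r (map (\<lambda>(x, D). (map_option snd x, end_fm D)) ps) c" "r \<noteq> EM" "r \<noteq> GEM"
      by (auto elim: derivation.cases)
    have "c = ?p" using Infer e by simp
    with i have "r \<in> elim_rules" by cases (auto simp: elim_rules_def)
    from normal_elim_open_compound[OF d n Infer this] show False unfolding o oaD by auto
  qed
  ultimately show ?thesis by (metis end_fm.simps(2))
qed

end

theory Submission
  imports Defs
begin

text \<open>
  Normalization by evaluation.  A formula is interpreted by a predicate on contexts \<open>\<Gamma>\<close> (worlds),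
  in the style of Beth models: atoms and negated atoms mean normal derivability from \<open>\<Gamma>\<close>, and
  disjunctive formulas hold locally, that is, after finitely many case distinctions of the kind
  that (\<open>\<or>\<close>E), (\<open>\<sim>\<and>\<close>E), (EM) and (GEM) perform.  Every derivation is sound for this interpretation,
  every assumption holds in a context containing it (reflection), and what holds in a context is
  normally derivable from it (reification).  This may lose open assumptions; a final (EM) or (GEM)
  that discharges an implication from the lost formula to the end-formula puts each of them back.
\<close>

section \<open>Normal and neutral derivations from a context\<close>

text \<open>The rules left out are exactly those whose conclusion can be a maximum formula, so a
  neutral derivation is safe as a major premise. Assumptions qualify vacuously.\<close>

definition neutral :: "deriv \<Rightarrow> bool" where
  "neutral D \<longleftrightarrow> (\<forall>r ps c. D = Infer r ps c \<longrightarrow> r \<in> elim_rules - {OrE, NegAndE})"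

text \<open>
  Contexts are sets of formulas and all leaves get the label 0, so that an inference discharges
  every occurrence of the formula in question.
\<close>

definition normal_from :: "system \<Rightarrow> fm set \<Rightarrow> fm \<Rightarrow> deriv \<Rightarrow> bool" where
  "normal_from N \<Gamma> a D \<longleftrightarrow>
    derivation N D \<and> normal D \<and> open_leaves D \<subseteq> {0} \<times> \<Gamma> \<and> end_fm D = a"

definition nf :: "system \<Rightarrow> fm set \<Rightarrow> fm \<Rightarrow> bool" where
  "nf N \<Gamma> a \<longleftrightarrow> (\<exists>D. normal_from N \<Gamma> a D)"

definition ne :: "system \<Rightarrow> fm set \<Rightarrow> fm \<Rightarrow> bool" where
  "ne N \<Gamma> a \<longleftrightarrow> (\<exists>D. normal_from N \<Gamma> a D \<and> neutral D)"

lemma normal_Assm [simp]: "normal (Assm n a)"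
  by (simp add: normal_def maximum_def)

lemma normal_Infer:
  "normal (Infer r ps c) \<longleftrightarrow>
    (\<forall>(x, D) \<in> set ps. normal D) \<and> (\<forall>M. \<not> maximum M (Infer r ps c))"
  by (auto simp: normal_def)

lemma neutral_not_maximum: "neutral M \<Longrightarrow> \<not> maximum M E"
  by (auto simp: neutral_def maximum_def intro_rules_def elim_rules_def)

lemma nf_mono: "nf N \<Gamma> a \<Longrightarrow> \<Gamma> \<subseteq> \<Delta> \<Longrightarrow> nf N \<Delta> a"
  unfolding nf_def normal_from_def by blast

lemma ne_mono: "ne N \<Gamma> a \<Longrightarrow> \<Gamma> \<subseteq> \<Delta> \<Longrightarrow> ne N \<Delta> a"
  unfolding ne_def normal_from_def by blast

lemma ne_imp_nf: "ne N \<Gamma> a \<Longrightarrow> nf N \<Gamma> a"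
  unfolding ne_def nf_def by blast

lemma ne_assm: "a \<in> \<Gamma> \<Longrightarrow> ne N \<Gamma> a"
  unfolding ne_def normal_from_def neutral_def
  by (rule exI[of _ "Assm 0 a"]) (auto intro: derivation.assm)

text \<open>Appending an inference to normal derivations can create a maximum formula only at the
  head premise of an elimination, and that premise is chosen neutral. The last inference is
  displayed in the conclusion so that neutrality of the result can be read off from
  \<open>r\<close>.\<close>

lemma normal_from_infer:
  assumes "r \<in> rules_of N" "inference r ps c"
    and nf: "\<And>x b. (x, b) \<in> set ps \<Longrightarrow> nf N (\<Gamma> \<union> set_option x) b"
    and ne: "r \<in> elim_rules \<Longrightarrow> ne N (\<Gamma> \<union> set_option (fst (hd ps))) (snd (hd ps))"
  shows "\<exists>qs. normal_from N \<Gamma> c (Infer r qs c)"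
proof -
  have "\<exists>D. normal_from N (\<Gamma> \<union> set_option (fst p)) (snd p) D \<and>
      (r \<in> elim_rules \<longrightarrow> p = hd ps \<longrightarrow> neutral D)"
    if "p \<in> set ps" for p
    using nf[of "fst p" "snd p"] ne that by (auto simp: nf_def ne_def)
  then obtain f where
    f: "\<And>p. p \<in> set ps \<Longrightarrow> normal_from N (\<Gamma> \<union> set_option (fst p)) (snd p) (f p)" and
    f_hd: "\<And>p. p \<in> set ps \<Longrightarrow> r \<in> elim_rules \<Longrightarrow> p = hd ps \<Longrightarrow> neutral (f p)"
    by metis
  define qs where "qs = map (\<lambda>p. (map_option (Pair (0::nat)) (fst p), f p)) ps"
  have "map (\<lambda>(x, D). (map_option snd x, end_fm D)) qs = ps"
    unfolding qs_def map_map
    by (rule map_idI) (auto simp: option.map_comp o_def option.map_ident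
        dest!: f simp: normal_from_def)
  then have "derivation N (Infer r qs c)"
    using assms(1,2) f by (intro derivation.infer) (auto simp: qs_def normal_from_def)
  moreover have "\<not> maximum M (Infer r qs c)" for M
  proof
    assume max: "maximum M (Infer r qs c)"
    then obtain x rs where "qs = (x, M) # rs" "r \<in> elim_rules" by (auto simp: maximum_def)
    then have "neutral M" using f_hd[of "hd ps"] by (cases ps) (auto simp: qs_def)
    then show False using max neutral_not_maximum by blast
  qed
  then have "normal (Infer r qs c)"
    using f by (auto simp: normal_Infer qs_def normal_from_def)
  moreover have "open_leaves (Infer r qs c) \<subseteq> {0} \<times> \<Gamma>"
  proof -
    \<comment> \<open>Every leaf is labelled 0, so removing \<open>(0, a)\<close> closes all
      occurrences of the discharged \<open>a\<close> and only leaves over \<Gamma> remain.\<close>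
    have "open_leaves (f p) - set_option (map_option (Pair 0) (fst p)) \<subseteq> {0} \<times> \<Gamma>"
      if "p \<in> set ps" for p
      using f[OF that] by (auto simp: normal_from_def option.set_map)
    then show ?thesis by (fastforce simp: qs_def)
  qed
  ultimately show ?thesis by (auto simp: normal_from_def)
qed

lemma nf_infer:
  assumes "inference r ps c" "r \<in> rules_of N"
    and "\<forall>(x, b) \<in> set ps. nf N (\<Gamma> \<union> set_option x) b"
    and "r \<in> elim_rules \<longrightarrow> ne N (\<Gamma> \<union> set_option (fst (hd ps))) (snd (hd ps))"
  shows "nf N \<Gamma> c"
  using normal_from_infer[OF assms(2,1)] assms(3,4) by (fastforce simp: nf_def)

lemma basic_rule: "r \<noteq> EM \<Longrightarrow> r \<noteq> GEM \<Longrightarrow> r \<in> rules_of N"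
  by (cases N) auto

lemma ne_infer:
  assumes "inference r ps c" "r \<in> elim_rules - {OrE, NegAndE}"
    and "\<forall>(x, b) \<in> set ps. nf N (\<Gamma> \<union> set_option x) b"
    and "ne N (\<Gamma> \<union> set_option (fst (hd ps))) (snd (hd ps))"
  shows "ne N \<Gamma> c"
proof -
  have "r \<in> rules_of N" using assms(2) by (intro basic_rule) (auto simp: elim_rules_def)
  moreover have "nf N (\<Gamma> \<union> set_option x) b" if "(x, b) \<in> set ps" for x b
    using assms(3) that by blast
  ultimately obtain qs where "normal_from N \<Gamma> c (Infer r qs c)"
    using normal_from_infer[OF _ assms(1)] assms(4) by blast
  moreover have "neutral (Infer r qs c)" using assms(2) by (simp add: neutral_def)
  ultimately show ?thesis by (auto simp: ne_def)
qed

section \<open>Trees of case distinctions\<close>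

text \<open>
  \<open>cover N P \<Gamma>\<close>: the predicate \<open>P\<close> holds at the ends of a tree of case distinctions starting in \<open>\<Gamma>\<close>.
\<close>

inductive cover :: "system \<Rightarrow> (fm set \<Rightarrow> bool) \<Rightarrow> fm set \<Rightarrow> bool" for N P where
  unit: "P \<Gamma> \<Longrightarrow> cover N P \<Gamma>"
| orE: "ne N \<Gamma> (Or a b) \<Longrightarrow> cover N P (insert a \<Gamma>) \<Longrightarrow> cover N P (insert b \<Gamma>) \<Longrightarrow> cover N P \<Gamma>"
| negAndE: "ne N \<Gamma> (Neg (And a b)) \<Longrightarrow> cover N P (insert (Neg a) \<Gamma>) \<Longrightarrow>
    cover N P (insert (Neg b) \<Gamma>) \<Longrightarrow> cover N P \<Gamma>"
| em: "EM \<in> rules_of N \<Longrightarrow> cover N P (insert (Neg a) \<Gamma>) \<Longrightarrow> cover N P (insert a \<Gamma>) \<Longrightarrow> cover N P \<Gamma>"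
| gem: "GEM \<in> rules_of N \<Longrightarrow> cover N P (insert (Imp a b) \<Gamma>) \<Longrightarrow> cover N P (insert a \<Gamma>) \<Longrightarrow>
    cover N P \<Gamma>"

text \<open>The same tree works over \<Delta> because \<open>ne\<close> is monotone. Its leaf
  contexts grow with it: \<open>P\<close> is known at \<Theta>, while \<open>Q\<close> is wanted at
  a larger \<Theta>' above \<Delta>.\<close>

lemma cover_mono:
  assumes "cover N P \<Gamma>" "\<Gamma> \<subseteq> \<Delta>" "\<And>\<Theta> \<Theta>'. \<Theta> \<subseteq> \<Theta>' \<Longrightarrow> \<Delta> \<subseteq> \<Theta>' \<Longrightarrow> P \<Theta> \<Longrightarrow> Q \<Theta>'"
  shows "cover N Q \<Delta>"
  using assms
proof (induction arbitrary: \<Delta> rule: cover.induct)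
  case (unit \<Gamma>)
  then show ?case by (blast intro: cover.unit)
next
  case (orE \<Gamma> a b)
  show ?case
    by (rule cover.orE[OF ne_mono[OF orE.hyps(1) orE.prems(1)] orE.IH])
      (use orE.prems in auto)
next
  case (negAndE \<Gamma> a b)
  show ?case
    by (rule cover.negAndE[OF ne_mono[OF negAndE.hyps(1) negAndE.prems(1)] negAndE.IH])
      (use negAndE.prems in auto)
next
  case (em a \<Gamma>)
  show ?case by (rule cover.em[OF em.hyps(1) em.IH]) (use em.prems in auto)
next
  case (gem a b \<Gamma>)
  show ?case by (rule cover.gem[OF gem.hyps(1) gem.IH]) (use gem.prems in auto)
qed

text \<open>Trees are grafted onto the leaves of a tree.\<close>

lemma cover_join: "cover N (cover N P) \<Gamma> \<Longrightarrow> cover N P \<Gamma>"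
  by (induction rule: cover.induct)
    (assumption | erule (2) cover.orE cover.negAndE cover.em cover.gem)+

text \<open>Each node of the tree becomes one inference by \<open>OrE\<close>,
  \<open>NegAndE\<close>, \<open>EM\<close> or \<open>GEM\<close>. The major premises are neutral,
  so normality survives.\<close>

lemma nf_cover: "cover N (\<lambda>\<Delta>. nf N \<Delta> c) \<Gamma> \<Longrightarrow> nf N \<Gamma> c"
proof (induction rule: cover.induct)
  case (unit \<Gamma>)
  then show ?case .
next
  case (orE \<Gamma> a b)
  show ?case
    by (rule nf_infer[OF inference.intros(8)[of a b]])
      (simp_all add: basic_rule orE.hyps orE.IH ne_imp_nf)
next
  case (negAndE \<Gamma> a b)
  show ?case
    by (rule nf_infer[OF inference.intros(15)[of a b]])
      (simp_all add: basic_rule negAndE.hyps negAndE.IH ne_imp_nf)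
next
  case (em a \<Gamma>)
  show ?case
    by (rule nf_infer[OF inference.intros(19)[of a]])
      (simp_all add: elim_rules_def em.hyps em.IH)
next
  case (gem a b \<Gamma>)
  show ?case
    by (rule nf_infer[OF inference.intros(20)[of a b]])
      (simp_all add: elim_rules_def gem.hyps gem.IH)
qed

section \<open>The interpretation, its monotonicity and its locality\<close>

text \<open>The meaning of \<open>a\<close> does not determine that of \<open>Neg a\<close>, so
  every shape of negated formula has a clause modelled on its own rules; in particular
  \<open>Neg (Imp a b)\<close> is read like \<open>Imp a (Neg b)\<close>.\<close>

fun sem :: "system \<Rightarrow> fm \<Rightarrow> fm set \<Rightarrow> bool" where
  "sem N (Var n) = (\<lambda>\<Gamma>. nf N \<Gamma> (Var n))"
| "sem N (And a b) = (\<lambda>\<Gamma>. sem N a \<Gamma> \<and> sem N b \<Gamma>)"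
| "sem N (Or a b) = cover N (\<lambda>\<Gamma>. sem N a \<Gamma> \<or> sem N b \<Gamma>)"
| "sem N (Imp a b) = (\<lambda>\<Gamma>. \<forall>\<Delta>. \<Gamma> \<subseteq> \<Delta> \<longrightarrow> sem N a \<Delta> \<longrightarrow> sem N b \<Delta>)"
| "sem N (Neg (Var n)) = (\<lambda>\<Gamma>. nf N \<Gamma> (Neg (Var n)))"
| "sem N (Neg (Neg a)) = sem N a"
| "sem N (Neg (Imp a b)) = (\<lambda>\<Gamma>. \<forall>\<Delta>. \<Gamma> \<subseteq> \<Delta> \<longrightarrow> sem N a \<Delta> \<longrightarrow> sem N (Neg b) \<Delta>)"
| "sem N (Neg (And a b)) = cover N (\<lambda>\<Gamma>. sem N (Neg a) \<Gamma> \<or> sem N (Neg b) \<Gamma>)"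
| "sem N (Neg (Or a b)) = (\<lambda>\<Gamma>. sem N (Neg a) \<Gamma> \<and> sem N (Neg b) \<Gamma>)"

text \<open>This follows the recursion of \<open>sem\<close>: \<open>Neg a\<close> is not a
  subformula of \<open>Neg (And a b)\<close>, but it is smaller.\<close>

lemma neg_cases_induct [case_names Var And Or Imp NegVar NegNeg NegImp NegAnd NegOr]:
  fixes a :: fm
  assumes "\<And>n. P (Var n)"
    and "\<And>a b. P a \<Longrightarrow> P b \<Longrightarrow> P (And a b)"
    and "\<And>a b. P a \<Longrightarrow> P b \<Longrightarrow> P (Or a b)"
    and "\<And>a b. P a \<Longrightarrow> P b \<Longrightarrow> P (Imp a b)"
    and "\<And>n. P (Neg (Var n))"
    and "\<And>a. P a \<Longrightarrow> P (Neg (Neg a))"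
    and "\<And>a b. P a \<Longrightarrow> P (Neg b) \<Longrightarrow> P (Neg (Imp a b))"
    and "\<And>a b. P (Neg a) \<Longrightarrow> P (Neg b) \<Longrightarrow> P (Neg (And a b))"
    and "\<And>a b. P (Neg a) \<Longrightarrow> P (Neg b) \<Longrightarrow> P (Neg (Or a b))"
  shows "P a"
  using assms by induction_schema (pat_completeness, lexicographic_order)

lemma sem_mono: "sem N a \<Gamma> \<Longrightarrow> \<Gamma> \<subseteq> \<Delta> \<Longrightarrow> sem N a \<Delta>"
proof (induction a arbitrary: \<Gamma> \<Delta> rule: neg_cases_induct)
  case (Or a b)
  show ?case
    unfolding sem.simps
    by (rule cover_mono[OF Or.prems[unfolded sem.simps]]) (use Or.IH in blast)
next
  case (NegAnd a b)
  show ?case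
    unfolding sem.simps
    by (rule cover_mono[OF NegAnd.prems[unfolded sem.simps]]) (use NegAnd.IH in blast)
next
  case (Var n)
  then show ?case unfolding sem.simps by (rule nf_mono)
next
  case (NegVar n)
  then show ?case unfolding sem.simps by (rule nf_mono)
next
  case (And a b)
  show ?case
    using And.prems(1) And.IH[OF _ And.prems(2)] unfolding sem.simps by blast
next
  case (NegOr a b)
  show ?case
    using NegOr.prems(1) NegOr.IH[OF _ NegOr.prems(2)] unfolding sem.simps by blast
next
  case (NegNeg a)
  show ?case using NegNeg.IH[OF _ NegNeg.prems(2)] NegNeg.prems(1) by simp
next
  case (Imp a b)
  show ?case using Imp.prems unfolding sem.simps by (meson subset_trans)
next
  case (NegImp a b)
  show ?case using NegImp.prems unfolding sem.simps by (meson subset_trans)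
qed

text \<open>The leaves of the transported tree lie above \<Delta>, so \<open>P\<close> has to yield
  \<open>c\<close> only there; an antecedent known at \<Delta> may then be used by
  monotonicity.\<close>

lemma cover_sem:
  assumes "cover N P \<Gamma>" "\<Gamma> \<subseteq> \<Delta>" "\<And>\<Theta>. \<Delta> \<subseteq> \<Theta> \<Longrightarrow> P \<Theta> \<Longrightarrow> sem N c \<Theta>"
    and "\<And>\<Theta> \<Theta>'. \<Theta> \<subseteq> \<Theta>' \<Longrightarrow> P \<Theta> \<Longrightarrow> P \<Theta>'"
  shows "cover N (sem N c) \<Delta>"
  by (rule cover_mono[OF assms(1,2)], rule assms(3), assumption, rule assms(4))

text \<open>Locality takes the place of permutative conversions. Atoms absorb the tree by
  \<open>nf_cover\<close>, disjunctive formulas by grafting; conjunctive formulas and implications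
  hand it on to their components.\<close>

lemma sem_cover: "cover N (sem N c) \<Gamma> \<Longrightarrow> sem N c \<Gamma>"
proof (induction c arbitrary: \<Gamma> rule: neg_cases_induct)
  case (And a b)
  have "cover N (sem N a) \<Gamma>" "cover N (sem N b) \<Gamma>"
    by (rule cover_sem[OF And.prems order_refl _ sem_mono]; simp)+
  then show ?case using And.IH by simp
next
  case (Imp a b)
  have "sem N b \<Delta>" if "\<Gamma> \<subseteq> \<Delta>" "sem N a \<Delta>" for \<Delta>
    by (rule Imp.IH(2), rule cover_sem[OF Imp.prems that(1) _ sem_mono])
      (use sem_mono[OF that(2)] in simp_all)
  then show ?case by simp
next
  case (NegImp a b)
  have "sem N (Neg b) \<Delta>" if "\<Gamma> \<subseteq> \<Delta>" "sem N a \<Delta>" for \<Delta>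
    by (rule NegImp.IH(2), rule cover_sem[OF NegImp.prems that(1) _ sem_mono])
      (use sem_mono[OF that(2)] in simp_all)
  then show ?case by simp
next
  case (NegOr a b)
  have "cover N (sem N (Neg a)) \<Gamma>" "cover N (sem N (Neg b)) \<Gamma>"
    by (rule cover_sem[OF NegOr.prems order_refl _ sem_mono]; simp)+
  then show ?case using NegOr.IH by simp
next
  case (Var n)
  then show ?case unfolding sem.simps by (rule nf_cover)
next
  case (NegVar n)
  then show ?case unfolding sem.simps by (rule nf_cover)
next
  case (Or a b)
  from Or.prems show ?case unfolding sem.simps by (rule cover_join)
next
  case (NegAnd a b)
  from NegAnd.prems show ?case unfolding sem.simps by (rule cover_join)
next
  case (NegNeg a)
  then show ?case unfolding sem.simps by blast
qed

section \<open>Reflection and reification\<close>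

text \<open>Both directions go through one induction because an implication is contravariant in its
  antecedent: reflecting it reifies the antecedent, and reifying it reflects the antecedent.\<close>

lemma reflect_reify:
  "(ne N \<Gamma> a \<longrightarrow> sem N a \<Gamma>) \<and> (sem N a \<Gamma> \<longrightarrow> nf N \<Gamma> a)"
proof (induction a arbitrary: \<Gamma> rule: neg_cases_induct)
  case (Var n)
  then show ?case by (simp add: ne_imp_nf)
next
  case (And a b)
  have "ne N \<Gamma> a" "ne N \<Gamma> b" if n: "ne N \<Gamma> (And a b)"
    by (rule ne_infer[OF inference.intros(4)[of a b]] ne_infer[OF inference.intros(5)[of a b]];
        simp add: elim_rules_def ne_imp_nf n)+
  moreover have "nf N \<Gamma> (And a b)" if "nf N \<Gamma> a" "nf N \<Gamma> b"
    by (rule nf_infer[OF inference.intros(3)])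
      (simp_all add: basic_rule elim_rules_def that)
  ultimately show ?case using And.IH by auto
next
  case (Or a b)
  have "sem N (Or a b) \<Gamma>" if "ne N \<Gamma> (Or a b)"
    \<comment> \<open>One split on the neutral disjunction suffices: in each branch the added
      disjunct is an assumption, hence neutral, hence true by induction.\<close>
    using cover.orE[OF that cover.unit cover.unit] Or.IH by (simp add: ne_assm)
  moreover have "nf N \<Gamma> (Or a b)" if sem: "sem N (Or a b) \<Gamma>"
  proof -
    have left: "nf N \<Delta> (Or a b)" if "nf N \<Delta> a" for \<Delta>
      by (rule nf_infer[OF inference.intros(6)]) (simp_all add: basic_rule elim_rules_def that)
    have right: "nf N \<Delta> (Or a b)" if "nf N \<Delta> b" for \<Delta>
      by (rule nf_infer[OF inference.intros(7)]) (simp_all add: basic_rule elim_rules_def that)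
    have step: "nf N \<Theta>' (Or a b)" if "\<Theta> \<subseteq> \<Theta>'" "sem N a \<Theta> \<or> sem N b \<Theta>" for \<Theta> \<Theta>'
      by (rule nf_mono[OF _ that(1)]) (use that(2) Or.IH left right in blast)
    show ?thesis
      by (rule nf_cover, rule cover_mono[OF sem[unfolded sem.simps] order_refl]) (rule step)
  qed
  ultimately show ?case by blast
next
  case (Imp a b)
  have "ne N \<Delta> b" if "ne N \<Gamma> (Imp a b)" "\<Gamma> \<subseteq> \<Delta>" "nf N \<Delta> a" for \<Delta>
    by (rule ne_infer[OF inference.intros(2)[of a b]])
      (use that in \<open>simp_all add: elim_rules_def ne_imp_nf ne_mono\<close>)
  moreover have "nf N \<Gamma> (Imp a b)" if "nf N (insert a \<Gamma>) b"
    by (rule nf_infer[OF inference.intros(1)])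
      (simp_all add: basic_rule elim_rules_def that)
  \<comment> \<open>To reify, the implication is evaluated at \<open>insert a \<Gamma>\<close>,
    where the antecedent holds by reflection.\<close>
  moreover have "sem N a (insert a \<Gamma>)" using Imp.IH(1) by (simp add: ne_assm)
  ultimately show ?case using Imp.IH by (auto simp: subset_insertI)
next
  case (NegVar n)
  then show ?case by (simp add: ne_imp_nf)
next
  case (NegNeg a)
  have "ne N \<Gamma> a" if n: "ne N \<Gamma> (Neg (Neg a))"
    by (rule ne_infer[OF inference.intros(10)])
      (simp_all add: elim_rules_def ne_imp_nf n)
  moreover have "nf N \<Gamma> (Neg (Neg a))" if "nf N \<Gamma> a"
    by (rule nf_infer[OF inference.intros(9)])
      (simp_all add: basic_rule elim_rules_def that)
  ultimately show ?case using NegNeg.IH by auto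
next
  case (NegImp a b)
  have "ne N \<Delta> (Neg b)" if "ne N \<Gamma> (Neg (Imp a b))" "\<Gamma> \<subseteq> \<Delta>" "nf N \<Delta> a" for \<Delta>
    by (rule ne_infer[OF inference.intros(12)[of a b]])
      (use that in \<open>simp_all add: elim_rules_def ne_imp_nf ne_mono\<close>)
  moreover have "nf N \<Gamma> (Neg (Imp a b))" if "nf N (insert a \<Gamma>) (Neg b)"
    by (rule nf_infer[OF inference.intros(11)])
      (simp_all add: basic_rule elim_rules_def that)
  moreover have "sem N a (insert a \<Gamma>)" using NegImp.IH(1) by (simp add: ne_assm)
  ultimately show ?case using NegImp.IH by (auto simp: subset_insertI)
next
  case (NegAnd a b)
  have "sem N (Neg (And a b)) \<Gamma>" if "ne N \<Gamma> (Neg (And a b))"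
    using cover.negAndE[OF that cover.unit cover.unit] NegAnd.IH by (simp add: ne_assm)
  moreover have "nf N \<Gamma> (Neg (And a b))" if sem: "sem N (Neg (And a b)) \<Gamma>"
  proof -
    have left: "nf N \<Delta> (Neg (And a b))" if "nf N \<Delta> (Neg a)" for \<Delta>
      by (rule nf_infer[OF inference.intros(13)]) (simp_all add: basic_rule elim_rules_def that)
    have right: "nf N \<Delta> (Neg (And a b))" if "nf N \<Delta> (Neg b)" for \<Delta>
      by (rule nf_infer[OF inference.intros(14)]) (simp_all add: basic_rule elim_rules_def that)
    have step: "nf N \<Theta>' (Neg (And a b))" if "\<Theta> \<subseteq> \<Theta>'" "sem N (Neg a) \<Theta> \<or> sem N (Neg b) \<Theta>" for \<Theta> \<Theta>'
      by (rule nf_mono[OF _ that(1)]) (use that(2) NegAnd.IH left right in blast)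
    show ?thesis
      by (rule nf_cover, rule cover_mono[OF sem[unfolded sem.simps] order_refl]) (rule step)
  qed
  ultimately show ?case by blast
next
  case (NegOr a b)
  have "ne N \<Gamma> (Neg a)" "ne N \<Gamma> (Neg b)" if n: "ne N \<Gamma> (Neg (Or a b))"
    by (rule ne_infer[OF inference.intros(17)[of a b]] ne_infer[OF inference.intros(18)[of a b]];
        simp add: elim_rules_def ne_imp_nf n)+
  moreover have "nf N \<Gamma> (Neg (Or a b))" if "nf N \<Gamma> (Neg a)" "nf N \<Gamma> (Neg b)"
    by (rule nf_infer[OF inference.intros(16)])
      (simp_all add: basic_rule elim_rules_def that)
  ultimately show ?case using NegOr.IH by auto
qed

section \<open>Soundness of the rules and of derivations\<close>

lemma sem_assm: "a \<in> \<Gamma> \<Longrightarrow> sem N a \<Gamma>"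
  using reflect_reify ne_assm by blast

text \<open>A premise with a discharge is read like an implication, over all extensions of \<Gamma>.
  The four case-distinction rules yield a cover of the conclusion, which locality collapses; the
  other rules match the clauses of \<open>sem\<close>.\<close>

lemma sem_inference:
  assumes "inference r ps c" "r \<in> rules_of N"
    and "\<forall>(x, b) \<in> set ps. case x of None \<Rightarrow> sem N b \<Gamma>
      | Some a \<Rightarrow> \<forall>\<Delta>. \<Gamma> \<subseteq> \<Delta> \<longrightarrow> sem N a \<Delta> \<longrightarrow> sem N b \<Delta>"
  shows "sem N c \<Gamma>"
  using assms(1)
proof cases
  \<comment> \<open>The numbered cases 8, 15, 19 and 20 are \<open>OrE\<close>,
    \<open>NegAndE\<close>, \<open>EM\<close> and \<open>GEM\<close>.\<close>
  case (8 a b)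
  have "cover N (\<lambda>\<Delta>. sem N a \<Delta> \<or> sem N b \<Delta>) \<Gamma>" using assms(3) 8 by simp
  moreover have "sem N c \<Delta>" if "\<Gamma> \<subseteq> \<Delta>" "sem N a \<Delta> \<or> sem N b \<Delta>" for \<Delta>
    using assms(3) that 8 by auto
  ultimately have "cover N (sem N c) \<Gamma>"
    by (rule cover_sem[OF _ order_refl])
      (assumption | (elim disj_forward; erule (1) sem_mono))+
  then show ?thesis by (rule sem_cover)
next
  case (15 a b)
  have "cover N (\<lambda>\<Delta>. sem N (Neg a) \<Delta> \<or> sem N (Neg b) \<Delta>) \<Gamma>" using assms(3) 15 by simp
  moreover have "sem N c \<Delta>" if "\<Gamma> \<subseteq> \<Delta>" "sem N (Neg a) \<Delta> \<or> sem N (Neg b) \<Delta>" for \<Delta>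
    using assms(3) that 15 by auto
  ultimately have "cover N (sem N c) \<Gamma>"
    by (rule cover_sem[OF _ order_refl])
      (assumption | (elim disj_forward; erule (1) sem_mono))+
  then show ?thesis by (rule sem_cover)
next
  case (19 a)
  \<comment> \<open>By reflection each discharged formula holds in the context enlarged by it, so
    both premises can be evaluated there.\<close>
  have "sem N c (insert (Neg a) \<Gamma>)" "sem N c (insert a \<Gamma>)"
    using assms(3) sem_assm[OF insertI1] unfolding 19 by (simp_all del: sem.simps add: subset_insertI)
  moreover have "EM \<in> rules_of N" using 19 assms(2) by simp
  ultimately have "cover N (sem N c) \<Gamma>" by (metis cover.em cover.unit)
  then show ?thesis by (rule sem_cover)
next
  case (20 a b)
  have "sem N c (insert (Imp a b) \<Gamma>)" "sem N c (insert a \<Gamma>)"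
    using assms(3) sem_assm[OF insertI1] unfolding 20 by (simp_all del: sem.simps add: subset_insertI)
  moreover have "GEM \<in> rules_of N" using 20 assms(2) by simp
  ultimately have "cover N (sem N c) \<Gamma>" by (metis cover.gem cover.unit)
  then show ?thesis by (rule sem_cover)
qed (use assms(3) in \<open>auto intro: cover.unit\<close>)

lemma oa_premise:
  assumes "(x, D) \<in> set ps" "b \<in> oa D"
  shows "b \<in> oa (Infer r ps c) \<or> map_option snd x = Some b"
  using assms by (cases x) (force simp: oa_def)+

lemma sem_sound:
  assumes "derivation N D" "\<And>a. a \<in> oa D \<Longrightarrow> sem N a \<Gamma>"
  shows "sem N (end_fm D) \<Gamma>"
  using assms
proof (induction arbitrary: \<Gamma> rule: derivation.induct)
  case (assm n a)
  then show ?case by (simp add: oa_def)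
next
  case (infer r ps c)
  have "sem N c \<Gamma>"
  proof (rule sem_inference[OF infer.hyps(2,1)], clarify)
    fix x b
    assume "(x, b) \<in> set (map (\<lambda>(x, D). (map_option snd x, end_fm D)) ps)"
    then obtain y D where D: "(y, D) \<in> set ps" "x = map_option snd y" "b = end_fm D" by auto
    \<comment> \<open>This treats both kinds of premise at once: \<Delta> is \<Gamma> if nothing is
      discharged, and otherwise any extension at which the discharged formula holds.\<close>
    have *: "sem N b \<Delta>" if "\<Gamma> \<subseteq> \<Delta>" "\<And>a. x = Some a \<Longrightarrow> sem N a \<Delta>" for \<Delta>
      unfolding D(3)
    proof (rule infer.IH[OF D(1)])
      fix a assume "a \<in> oa D"
      then show "sem N a \<Delta>"
        using oa_premise[OF D(1)] infer.prems sem_mono[OF _ that(1)] that(2) D(2) by metis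
    qed
    show "case x of None \<Rightarrow> sem N b \<Gamma>
        | Some a \<Rightarrow> \<forall>\<Delta>. \<Gamma> \<subseteq> \<Delta> \<longrightarrow> sem N a \<Delta> \<longrightarrow> sem N b \<Delta>"
      using * by (cases x) simp_all
  qed
  then show ?case by simp
qed

section \<open>Normal derivations that may lose assumptions\<close>

lemma ex_normal:
  assumes "derivation N D"
  shows "\<exists>D'. derivation N D' \<and> normal D' \<and> end_fm D' = end_fm D \<and> oa D' \<subseteq> oa D"
proof -
  \<comment> \<open>At the context \<open>oa D\<close> all open assumptions hold, so the end-formula
    holds there and is reified.\<close>
  have "nf N (oa D) (end_fm D)"
    using sem_sound[OF assms sem_assm] reflect_reify by blast
  then show ?thesis by (fastforce simp: nf_def normal_from_def oa_def)
qed

section \<open>Restoring the lost assumptions\<close>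

lemma finite_open_leaves: "finite (open_leaves D)"
  by (induction D rule: open_leaves.induct) auto

lemma add_assumption:
  assumes "N \<noteq> nC" "derivation N D" "normal D"
  shows "\<exists>D'. derivation N D' \<and> normal D' \<and> end_fm D' = end_fm D \<and> oa D' = insert q (oa D)"
proof -
  let ?c = "end_fm D"
  let ?E = "\<lambda>n. Infer ImpE [(None, Assm n (Imp q ?c)), (None, Assm n q)] ?c"
  \<comment> \<open>A label fresh for \<open>D\<close> makes the discharge in \<open>D\<close>
    vacuous, even if the formula itself is open in \<open>D\<close>.\<close>
  obtain n where n: "n \<notin> fst ` open_leaves D"
    using ex_new_if_finite[OF infinite_UNIV_nat] finite_open_leaves[of D] by blast
  then have vacuous: "open_leaves D - {(n, a)} = open_leaves D" for a by force
  have E: "derivation N (?E n)" "normal (?E n)"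
    by (rule derivation.infer)
      (use assms(1) in \<open>cases N; auto intro: inference.intros derivation.assm
        simp: normal_Infer maximum_def\<close>)+
  \<comment> \<open>The label is shared, but \<open>Imp q ?c\<close> differs from its subformula
    \<open>q\<close>, so the leaf for \<open>q\<close> stays open.\<close>
  have oa_E: "open_leaves (?E n) - {(n, Imp q ?c)} = {(n, q)}" by auto
  show ?thesis
  \<comment> \<open>Among the extensions of \<open>nC\<close> only \<open>nMC\<close> lacks
    \<open>EM\<close>, and it has \<open>GEM\<close>.\<close>
  proof (cases "N = nMC")
    case True
    let ?D = "Infer GEM [(Some (n, Imp q ?c), ?E n), (Some (n, q), D)] ?c"
    have "derivation N ?D"
      by (rule derivation.infer) (use True E assms(2) in \<open>auto intro: inference.intros\<close>)
    moreover have "normal ?D"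
      using E(2) assms(3) by (auto simp: normal_Infer[of GEM] maximum_def elim_rules_def)
    moreover have "oa ?D = insert q (oa D)"
      using oa_E vacuous by (simp add: oa_def)
    ultimately show ?thesis by (metis end_fm.simps(2))
  next
    case False
    let ?D = "Infer EM [(Some (n, Neg (Imp q ?c)), D), (Some (n, Imp q ?c), ?E n)] ?c"
    have "EM \<in> rules_of N" using False assms(1) by (cases N) auto
    then have "derivation N ?D"
      by (rule derivation.infer) (use E assms(2) in \<open>auto intro: inference.intros\<close>)
    moreover have "normal ?D"
      using E(2) assms(3) by (auto simp: normal_Infer[of EM] maximum_def elim_rules_def)
    moreover have "oa ?D = insert q (oa D)"
      using oa_E vacuous by (simp add: oa_def)
    ultimately show ?thesis by (metis end_fm.simps(2))
  qed
qed

lemma add_assumptions: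
  assumes "finite A" "N \<noteq> nC" "derivation N D" "normal D"
  shows "\<exists>D'. derivation N D' \<and> normal D' \<and> end_fm D' = end_fm D \<and> oa D' = A \<union> oa D"
  using assms
proof (induction A rule: finite_induct)
  case (insert q A)
  then obtain E where "derivation N E" "normal E" "end_fm E = end_fm D" "oa E = A \<union> oa D" by blast
  with add_assumption[OF insert.prems(1), of E q] show ?case by simp
qed auto

theorem theorem3p9:
  fixes N :: system and D :: deriv
  assumes "derivation N D"
  shows "\<exists>D'. derivation N D' \<and> normal D' \<and> end_fm D' = end_fm D \<and>
    oa D' \<subseteq> oa D \<and> (N \<noteq> nC \<longrightarrow> oa D' = oa D)"
proof -
  obtain E where E: "derivation N E" "normal E" "end_fm E = end_fm D" "oa E \<subseteq> oa D"
    using ex_normal[OF assms] by blast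
  show ?thesis
  proof (cases "N = nC")
    case True
    then show ?thesis using E by blast
  next
    case False
    have "finite (oa D)" by (simp add: oa_def finite_open_leaves)
    \<comment> \<open>All of \<open>oa D\<close> is added; since \<open>oa E\<close> lies inside it,
      the union is exactly \<open>oa D\<close>.\<close>
    from add_assumptions[OF this False E(1,2)] E(3,4) show ?thesis
      by (metis order_refl sup.absorb1)
  qed
qed

end
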